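(* Let $A\in\mathbb{R}^{m\times n}$ with $\operatorname{rank}(A)\ge 2$, let $b\in\mathbb{R}^m$, and suppose that the linear system $Ax=b$ is consistent. Let $r$ be a positive integer, $\alpha\in(0,1)$, and let $x^0\in\mathbb{R}^n$ be an arbitrary initial vector. Let $x_0^*=A^{\dagger}b+(I-A^\dagger A)x^0$. Then the iteration sequence $\{x^k\}_{k=0}^{\infty}$ generated by the randomized $r$-sets-Douglas-Rachford (RrDR) method satisfies, for all $k\ge 0$, $$\mathbb{E}\left[\|x^k-x_{0}^*\|^2_2\right]\leq\left(\alpha^2+(1-\alpha)^2+2\alpha(1-\alpha)\left(1-2\frac{\sigma_{\min}^2(A)}{\|A\|^2_F}\right)^r\right)^k\|x^0-x_{0}^*\|^2_2.$$
   Context: Notation: $a_1^\top,\dots,a_m^\top$ are the rows of $A$, $b=(b_1,\dots,b_m)^\top$, $A^\dagger$ is the Moore-Penrose pseudoinverse, $\|A\|_F$ the Frobenius norm, and $\sigma_{\min}(A)$ the smallest nonzero singular value of $A$. RrDR method: given a (deterministic) initial vector $x^0\in\mathbb{R}^n$, a positive integer $r$ and $\alpha\in(0,1)$, for each $k=0,1,2,\dots$ set $z_0^k:=x^k$; for $\ell=1,\dots,r$ select a random index $j_{k_\ell}\in\{1,\dots,m\}$, independently of all other selections, with $\Pr(j_{k_\ell}=i)=\|a_i\|_2^2/\|A\|_F^2$ (so zero rows are never selected), and set $$z_\ell^k:=z_{\ell-1}^k-2\frac{\langle a_{j_{k_\ell}},z_{\ell-1}^k\rangle-b_{j_{k_\ell}}}{\|a_{j_{k_\ell}}\|_2^2}\,a_{j_{k_\ell}};$$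 then set $x^{k+1}:=(1-\alpha)x^k+\alpha z_r^k$. The expectation is over all random row selections. *)

theory Defs
  imports "HOL-Probability.Probability"
begin

definition frobenius_norm :: "real^'n^'m \<Rightarrow> real" where
  "frobenius_norm A = sqrt (\<Sum>i\<in>UNIV. \<Sum>j\<in>UNIV. (A $ i $ j)\<^sup>2)"

text \<open>The four Penrose equations; they have exactly one solution for every real matrix.\<close>

definition is_moore_penrose :: "real^'n^'m \<Rightarrow> real^'m^'n \<Rightarrow> bool" where
  "is_moore_penrose A X \<longleftrightarrow>
     A ** X ** A = A \<and> X ** A ** X = X \<and>
     transpose (A ** X) = A ** X \<and> transpose (X ** A) = X ** A"

definition pinv :: "real^'n^'m \<Rightarrow> real^'m^'n" where
  "pinv A = (THE X. is_moore_penrose A X)"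

text \<open>Square roots of the eigenvalues of \<open>A\<^sup>T A\<close>. If \<open>A\<close> has more columns than rows, this set
  always contains 0; the nonzero members do not depend on whether \<open>A\<^sup>T A\<close> or \<open>A A\<^sup>T\<close> is used.\<close>

definition singular_values :: "real^'n^'m \<Rightarrow> real set" where
  "singular_values A =
     {sqrt c | c. \<exists>v. v \<noteq> 0 \<and> (transpose A ** A) *v v = c *\<^sub>R v}"

text \<open>Only meaningful for \<open>A \<noteq> 0\<close>; otherwise there is no nonzero singular value.\<close>

definition sigma_min :: "real^'n^'m \<Rightarrow> real" where
  "sigma_min A = (LEAST s. s \<in> singular_values A \<and> s \<noteq> 0)"

text \<open>Reflection of \<open>z\<close> in the hyperplane given by the \<open>i\<close>-th equation. For a zero row, which
  is selected with probability 0, division by zero makes this the identity.\<close>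

definition row_reflect :: "real^'n^'m \<Rightarrow> real^'m \<Rightarrow> 'm \<Rightarrow> real^'n \<Rightarrow> real^'n" where
  "row_reflect A b i z =
     z - (2 * ((row i A \<bullet> z - b $ i) / (norm (row i A))\<^sup>2)) *\<^sub>R row i A"

text \<open>\<open>rrdr_inner A b j z l\<close> is \<open>z\<^sub>l\<close>, started from \<open>z\<^sub>0 = z\<close>, with selected rows
  \<open>j 1, j 2, \<dots>\<close>; the value \<open>j 0\<close> is not used.\<close>

primrec rrdr_inner ::
    "real^'n^'m \<Rightarrow> real^'m \<Rightarrow> (nat \<Rightarrow> 'm) \<Rightarrow> real^'n \<Rightarrow> nat \<Rightarrow> real^'n" where
  "rrdr_inner A b j z 0 = z"
| "rrdr_inner A b j z (Suc l) = row_reflect A b (j (Suc l)) (rrdr_inner A b j z l)"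

text \<open>The iterates \<open>x\<^sup>k\<close> for the selections \<open>j k l\<close> (outer step \<open>k\<close>, inner step
  \<open>l \<in> {1..r}\<close>).\<close>

primrec rrdr ::
    "real^'n^'m \<Rightarrow> real^'m \<Rightarrow> nat \<Rightarrow> real \<Rightarrow> real^'n \<Rightarrow> (nat \<Rightarrow> nat \<Rightarrow> 'm) \<Rightarrow> nat \<Rightarrow> real^'n" where
  "rrdr A b r \<alpha> x0 j 0 = x0"
| "rrdr A b r \<alpha> x0 j (Suc k) =
     (1 - \<alpha>) *\<^sub>R rrdr A b r \<alpha> x0 j k
     + \<alpha> *\<^sub>R rrdr_inner A b (j k) (rrdr A b r \<alpha> x0 j k) r"

text \<open>\<open>J k l\<close> is the random row index selected in inner step \<open>l\<close> of outer step \<open>k\<close>; the whole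
  family is independent.\<close>

definition rrdr_sampling ::
    "real^'n^'m \<Rightarrow> nat \<Rightarrow> 'w measure \<Rightarrow> (nat \<Rightarrow> nat \<Rightarrow> 'w \<Rightarrow> 'm) \<Rightarrow> bool" where
  "rrdr_sampling A r M J \<longleftrightarrow>
     prob_space.indep_vars M (\<lambda>_. count_space UNIV) (\<lambda>(k, l). J k l) (UNIV \<times> {1..r}) \<and>
     (\<forall>k. \<forall>l\<in>{1..r}. \<forall>i.
        measure M {\<omega> \<in> space M. J k l \<omega> = i} = (norm (row i A))\<^sup>2 / (frobenius_norm A)\<^sup>2)"

end

theory Submission
  imports Defs
begin

text \<open>
  Write \<open>e\<close> for the current error \<open>x\<^sup>k - x\<^sub>0\<^sup>*\<close>. Reflections in hyperplanes through
  \<open>x\<^sub>0\<^sup>*\<close> act on it as linear isometries, so after an inner loop with composed reflection \<open>T\<close>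
  the new error is \<open>(1 - \<alpha>) e + \<alpha> T e\<close> and its squared norm is
  \<open>(\<alpha>\<^sup>2 + (1 - \<alpha>)\<^sup>2) \<parallel>e\<parallel>\<^sup>2 + 2 \<alpha> (1 - \<alpha>) \<langle>e, T e\<rangle>\<close>. Only the cross term is random given \<open>e\<close>.
  The selections of the loop are independent of each other and of \<open>e\<close>, and one random reflection
  has mean \<open>M = I - 2 A\<^sup>T A / \<parallel>A\<parallel>\<^sub>F\<^sup>2\<close> (\<open>mean_row_reflect\<close>), so the mean of the cross term is that
  of \<open>\<langle>M\<^sup>r e, e\<rangle>\<close> (\<open>expectation_inner_rrdr_inner\<close>).

  The error never leaves the row space of \<open>A\<close>: it starts there by the choice of \<open>x\<^sub>0\<^sup>*\<close>
  (\<open>pinv_projection_diff\<close>), and every reflection moves it along a row. For a unit vector \<open>v\<close> of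
  the row space \<open>\<parallel>A v\<parallel>\<^sup>2\<close> lies between \<open>\<sigma>\<^sub>m\<^sub>i\<^sub>n\<^sup>2\<close> (\<open>sigma_min_rayleigh\<close>) and
  \<open>\<parallel>A\<parallel>\<^sub>F\<^sup>2 - \<sigma>\<^sub>m\<^sub>i\<^sub>n\<^sup>2\<close> (\<open>rayleigh_upper\<close>); the upper bound is where rank at least 2 is needed. The two
  bounds say that \<open>\<langle>M v, v\<rangle>\<close> lies in \<open>[-\<rho>, \<rho>]\<close> for \<open>\<rho> = 1 - 2 \<sigma>\<^sub>m\<^sub>i\<^sub>n\<^sup>2 / \<parallel>A\<parallel>\<^sub>F\<^sup>2\<close>, and since \<open>M\<close> is
  symmetric it contracts the row space by the factor \<open>\<rho>\<close> (\<open>mean_reflection_contraction\<close>). Hence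
  \<open>\<langle>M\<^sup>r e, e\<rangle> \<le> \<rho>\<^sup>r \<parallel>e\<parallel>\<^sup>2\<close>, which gives the rate for one outer step.

  The lower bound on \<open>\<parallel>A v\<parallel>\<^sup>2\<close> holds because a minimizer of the Rayleigh quotient is an
  eigenvector, so that the minimum is \<open>\<sigma>\<^sub>m\<^sub>i\<^sub>n\<^sup>2\<close>. The upper bound follows from the lower bound at a unit
  vector of the row space orthogonal to \<open>v\<close>, by Bessel's inequality for each row.
\<close>

section \<open>The Moore-Penrose inverse\<close>

text \<open>Applied to vectors \<open>d = P x - Q x\<close>: \<open>A\<^sup>T A d = 0\<close> implies \<open>\<parallel>A d\<parallel>\<^sup>2 = \<langle>A\<^sup>T A d, d\<rangle> = 0\<close>.\<close>

lemma gram_cancel_left: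
  fixes A :: "real^'n^'m"
  assumes "transpose A ** A ** P = transpose A ** A ** Q"
  shows "A ** P = A ** Q"
proof (subst matrix_eq, intro allI)
  fix x
  define d where "d = P *v x - Q *v x"
  have "transpose A *v (A *v d) = 0"
    using arg_cong[OF assms, of "\<lambda>B. B *v x"]
    by (simp add: d_def matrix_vector_mult_diff_distrib matrix_vector_mul_assoc
        matrix_mul_assoc del: transpose_matrix_vector)
  hence "(A *v d) \<bullet> (A *v d) = 0"
    by (metis dot_lmul_matrix inner_zero_left transpose_matrix_vector)
  thus "(A ** P) *v x = (A ** Q) *v x"
    by (simp add: d_def matrix_vector_mult_diff_distrib matrix_vector_mul_assoc)
qed

lemma generalized_inverse_exists:
  fixes C :: "real^'n^'m"
  shows "\<exists>G. C ** G ** C = C"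
proof -
  have "\<exists>g. g ` UNIV \<subseteq> UNIV \<and> linear g \<and> (\<forall>v\<in>range ((*v) C). C *v g v = v)"
    by (rule linear_exists_right_inverse_on) auto
  then obtain g where g: "linear g" "\<And>x. C *v g (C *v x) = C *v x"
    by blast
  have "C ** matrix g ** C = C"
    by (subst matrix_eq)
      (metis g matrix_vector_mul(2) matrix_vector_mul_assoc)
  thus ?thesis ..
qed

lemma generalized_inverse_cancel:
  fixes A :: "real^'n^'m"
  assumes "(transpose A ** A ** transpose A) ** G ** (transpose A ** A ** transpose A)
    = transpose A ** A ** transpose A"
  shows "transpose A ** G ** transpose A ** A ** transpose A = transpose A"
proof -
  have "transpose A ** A ** (transpose A ** G ** transpose A ** A ** transpose A)
      = transpose A ** A ** transpose A"
    using assms by (simp add: matrix_mul_assoc)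
  from gram_cancel_left[OF this]
  have "transpose (transpose A) ** transpose A ** (G ** transpose A ** A ** transpose A)
      = transpose (transpose A) ** transpose A ** mat 1"
    by (simp add: matrix_mul_assoc)
  from gram_cancel_left[OF this] show ?thesis
    by (simp add: matrix_mul_assoc)
qed

text \<open>Any generalized inverse \<open>G\<close> of \<open>C = A\<^sup>T A A\<^sup>T\<close> yields the pseudoinverse
  \<open>X = A\<^sup>T G A\<^sup>T\<close>: cancelling Gram matrices in \<open>C G C = C\<close> and in its transpose leaves
  \<open>X A A\<^sup>T = A\<^sup>T\<close> and \<open>A\<^sup>T A X = A\<^sup>T\<close>, from which all four Penrose equations follow.\<close>

lemma moore_penrose_exists:
  fixes A :: "real^'n^'m"
  shows "\<exists>X. is_moore_penrose A X"
proof -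
  let ?T = "transpose A"
  obtain G where G: "(?T ** A ** ?T) ** G ** (?T ** A ** ?T) = ?T ** A ** ?T"
    using generalized_inverse_exists by blast
  define X where "X = ?T ** G ** ?T"
  have XAT: "X ** A ** ?T = ?T"
    using generalized_inverse_cancel[OF G] by (simp add: X_def)
  have "A ** transpose G ** A ** ?T ** A = A"
    using generalized_inverse_cancel[of ?T "transpose G"] arg_cong[OF G, of transpose]
    by (simp add: matrix_transpose_mul matrix_mul_assoc)
  from arg_cong[OF this, of transpose] have ATX: "?T ** A ** X = ?T"
    by (simp add: X_def matrix_transpose_mul matrix_mul_assoc)
  have AXA': "A ** transpose (X ** A) = A"
    using arg_cong[OF XAT, of transpose] by (simp add: matrix_transpose_mul matrix_mul_assoc)
  have XA: "transpose (X ** A) = X ** A"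
  proof -
    have "X ** A = X ** A ** transpose (X ** A)"
      by (metis AXA' matrix_mul_assoc)
    thus ?thesis
      by (metis matrix_transpose_mul transpose_transpose)
  qed
  have AX: "transpose (A ** X) = A ** X"
  proof -
    have "transpose (A ** X) ** A = A"
      using arg_cong[OF ATX, of transpose] by (simp add: matrix_transpose_mul matrix_mul_assoc)
    hence "A ** X = transpose (A ** X) ** (A ** X)"
      by (metis matrix_mul_assoc)
    thus ?thesis
      by (metis matrix_transpose_mul transpose_transpose)
  qed
  have "A ** X ** A = A"
    using AXA' XA by (simp add: matrix_mul_assoc)
  moreover have "X ** A ** X = X"
    using XAT by (simp add: X_def matrix_mul_assoc)
  ultimately show ?thesis
    using XA AX unfolding is_moore_penrose_def by blast
qed

lemma moore_penrose_unique:
  fixes A :: "real^'n^'m"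
  assumes X: "is_moore_penrose A X" and Y: "is_moore_penrose A Y"
  shows "X = Y"
proof -
  have "A ** X = (A ** Y) ** (A ** X)"
    using Y by (simp add: is_moore_penrose_def matrix_mul_assoc)
  also have "\<dots> = transpose (transpose (A ** X) ** transpose (A ** Y))"
    by (simp add: matrix_transpose_mul)
  also have "\<dots> = transpose (A ** X ** A ** Y)"
    using X Y by (simp add: is_moore_penrose_def matrix_mul_assoc)
  also have "\<dots> = A ** Y"
    using X Y by (simp add: is_moore_penrose_def)
  finally have AX: "A ** X = A ** Y" .
  have "X ** A = (X ** A) ** (Y ** A)"
    using Y by (metis is_moore_penrose_def matrix_mul_assoc)
  also have "\<dots> = transpose (transpose (Y ** A) ** transpose (X ** A))"
    by (simp add: matrix_transpose_mul)
  also have "\<dots> = transpose (Y ** (A ** X ** A))"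
    using X Y by (metis is_moore_penrose_def matrix_mul_assoc)
  also have "\<dots> = Y ** A"
    using X Y by (simp add: is_moore_penrose_def del: matrix_transpose_mul)
  finally have XA: "X ** A = Y ** A" .
  have "X = X ** A ** X"
    using X by (simp add: is_moore_penrose_def)
  also have "\<dots> = Y ** (A ** Y)"
    unfolding XA by (simp add: AX flip: matrix_mul_assoc)
  also have "\<dots> = Y"
    using Y by (simp add: is_moore_penrose_def matrix_mul_assoc)
  finally show ?thesis .
qed

lemma is_moore_penrose_pinv: "is_moore_penrose A (pinv A)"
  unfolding pinv_def
  by (rule theI') (use moore_penrose_exists moore_penrose_unique in blast)

text \<open>For any solution \<open>x\<close> the difference \<open>x0 - xstar\<close> equals \<open>A\<^sup>\<dagger> A (x0 - x)\<close>, and by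
  symmetry \<open>A\<^sup>\<dagger> A = A\<^sup>T (A\<^sup>\<dagger>)\<^sup>T\<close>. Thus \<open>xstar\<close> is the orthogonal projection of \<open>x0\<close> onto the
  solution set.\<close>

lemma pinv_projection:
  fixes A :: "real^'n^'m"
  assumes "\<exists>x. A *v x = b"
    and xstar: "xstar = pinv A *v b + (mat 1 - pinv A ** A) *v x0"
  shows pinv_projection_solves: "A *v xstar = b"
    and pinv_projection_diff: "x0 - xstar \<in> span (rows A)"
proof -
  let ?X = "pinv A"
  obtain x where x: "A *v x = b"
    using assms(1) by blast
  have X: "A ** ?X ** A = A" "transpose (?X ** A) = ?X ** A"
    using is_moore_penrose_pinv[of A] by (auto simp: is_moore_penrose_def)
  have d: "x0 - xstar = (?X ** A) *v (x0 - x)"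
    unfolding xstar x[symmetric]
    by (simp add: matrix_vector_mult_diff_rdistrib matrix_vector_mult_diff_distrib
        matrix_vector_mul_assoc)
  have "A *v (x0 - xstar) = A *v (x0 - x)"
    unfolding d by (simp add: matrix_vector_mul_assoc matrix_mul_assoc X)
  thus "A *v xstar = b"
    by (simp add: x matrix_vector_mult_diff_distrib)
  have "x0 - xstar = transpose A *v (transpose ?X *v (x0 - x))"
    unfolding d
    by (metis X(2) matrix_transpose_mul matrix_vector_mul_assoc)
  thus "x0 - xstar \<in> span (rows A)"
    by (metis columns_transpose matrix_vector_mult_in_columnspace)
qed

section \<open>The smallest nonzero singular value\<close>

lemma inner_transpose_mult:
  fixes A :: "real^'n^'m"
  shows "(transpose A *v y) \<bullet> x = y \<bullet> (A *v x)"
  by (simp add: dot_lmul_matrix)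

lemma transpose_mult_in_row_space:
  fixes A :: "real^'n^'m"
  shows "transpose A *v y \<in> span (rows A)"
  by (metis columns_transpose matrix_vector_mult_in_columnspace)

lemma row_eq_nth: "row i A = A $ i"
  by (simp add: row_def)

lemma row_space_kernel_trivial:
  fixes A :: "real^'n^'m"
  assumes "v \<in> span (rows A)" and "A *v v = 0"
  shows "v = 0"
proof -
  have "A $ i \<bullet> v = 0" for i
    using assms(2) by (metis matrix_vector_mul_component zero_index)
  hence "orthogonal v w" if "w \<in> rows A" for w
    using that by (auto simp: rows_def orthogonal_def row_eq_nth inner_commute)
  hence "orthogonal v v"
    by (rule orthogonal_to_span[OF assms(1)])
  thus ?thesis by (simp add: orthogonal_def)
qed

text \<open>A minimizer \<open>v\<close> of the Rayleigh quotient over the row space is an eigenvector of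
  \<open>A\<^sup>T A\<close>: the form \<open>q w = \<parallel>A w\<parallel>\<^sup>2 - c \<parallel>w\<parallel>\<^sup>2\<close> is nonnegative there and vanishes at \<open>v\<close>, so
  its derivative at \<open>v\<close> in the direction of the defect \<open>A\<^sup>T A v - c v\<close> vanishes.\<close>

lemma rayleigh_minimizer_eigenvector:
  fixes A :: "real^'n^'m"
  assumes v: "v \<in> span (rows A)" and c: "(norm (A *v v))\<^sup>2 = c * (norm v)\<^sup>2"
    and min: "\<And>w. w \<in> span (rows A) \<Longrightarrow> c * (norm w)\<^sup>2 \<le> (norm (A *v w))\<^sup>2"
  shows "(transpose A ** A) *v v = c *\<^sub>R v"
proof -
  define d where "d = transpose A *v (A *v v) - c *\<^sub>R v"
  have dR: "d \<in> span (rows A)"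
    unfolding d_def by (intro span_diff span_scale v transpose_mult_in_row_space)
  have dd: "d \<bullet> d = (A *v v) \<bullet> (A *v d) - c * (v \<bullet> d)"
    by (subst (1) d_def) (simp add: inner_diff_left inner_transpose_mult del: transpose_matrix_vector)
  define q where "q = (norm (A *v d))\<^sup>2 - c * (norm d)\<^sup>2"
  have pos: "0 \<le> 2 * t * (d \<bullet> d) + t\<^sup>2 * q" for t
  proof -
    have "c * (norm (v + t *\<^sub>R d))\<^sup>2 \<le> (norm (A *v (v + t *\<^sub>R d)))\<^sup>2"
      by (intro min span_add span_scale v dR)
    moreover have "A *v (v + t *\<^sub>R d) = A *v v + t *\<^sub>R (A *v d)"
      by (simp add: matrix_vector_right_distrib matrix_vector_mult_scaleR)
    ultimately have "0 \<le> (norm (A *v v + t *\<^sub>R (A *v d)))\<^sup>2 - c * (norm (v + t *\<^sub>R d))\<^sup>2"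
      by simp
    also have "\<dots> = 2 * t * (d \<bullet> d) + t\<^sup>2 * q"
      unfolding dd q_def using c unfolding power2_norm_eq_inner
      by (simp add: inner_add_left inner_add_right inner_commute power2_eq_square algebra_simps)
    finally show ?thesis .
  qed
  have "d \<bullet> d = 0"
  proof (rule ccontr)
    assume "d \<bullet> d \<noteq> 0"
    hence d: "d \<bullet> d > 0" by simp
    \<comment> \<open>a step this small against the gradient makes the linear term dominate\<close>
    define t where "t = - (d \<bullet> d) / (\<bar>q\<bar> + 1)"
    have t: "t < 0" using d by (simp add: t_def field_simps)
    have "0 \<le> t * (2 * (d \<bullet> d) + t * q)"
      using pos[of t] by (simp add: power2_eq_square algebra_simps)
    hence "2 * (d \<bullet> d) + t * q \<le> 0"
      using t by (simp add: zero_le_mult_iff)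
    moreover have "\<bar>t * q\<bar> \<le> d \<bullet> d"
      using d by (simp add: t_def abs_mult field_simps)
    ultimately show False using d by linarith
  qed
  thus ?thesis
    by (simp add: d_def matrix_vector_mul_assoc del: transpose_matrix_vector)
qed

text \<open>The Rayleigh quotient attains a minimum \<open>c\<close> on the unit sphere of the row space, and \<open>c\<close>
  is positive because the row space meets the kernel only in 0. So \<open>sqrt c\<close> is a nonzero singular
  value, and it is the least one: eigenvectors of \<open>A\<^sup>T A\<close> for other nonzero eigenvalues lie in
  the row space as well and have their eigenvalue as Rayleigh quotient.\<close>

lemma sigma_min_rayleigh:
  fixes A :: "real^'n^'m"
  assumes "A \<noteq> 0" and x: "x \<in> span (rows A)"
  shows "(sigma_min A)\<^sup>2 * (norm x)\<^sup>2 \<le> (norm (A *v x))\<^sup>2"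
proof -
  let ?S = "span (rows A) \<inter> sphere 0 1"
  have "span (rows A) \<noteq> {0}"
  proof
    assume "span (rows A) = {0}"
    hence "\<And>i. row i A = 0"
      by (metis (mono_tags, lifting) UNIV_I mem_Collect_eq rows_def singletonD span_base)
    hence "A = 0"
      by (simp add: vec_eq_iff row_def)
    with assms(1) show False ..
  qed
  then obtain u where u: "u \<in> span (rows A)" "u \<noteq> 0"
    using span_zero by blast
  have "(1 / norm u) *\<^sub>R u \<in> ?S"
    using u by (simp add: span_scale)
  hence "?S \<noteq> {}" by blast
  moreover have "compact ?S"
    by (intro closed_Int_compact closed_span compact_sphere)
  moreover have "continuous_on ?S (\<lambda>v. (norm (A *v v))\<^sup>2)"
    by (intro continuous_intros matrix_vector_mult_linear_continuous_on)
  ultimately obtain v where "v \<in> ?S"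
    and vmin: "\<And>w. w \<in> ?S \<Longrightarrow> (norm (A *v v))\<^sup>2 \<le> (norm (A *v w))\<^sup>2"
    using continuous_attains_inf[of ?S "\<lambda>v. (norm (A *v v))\<^sup>2"] by blast
  hence v: "v \<in> span (rows A)" "norm v = 1" by simp_all
  define c where "c = (norm (A *v v))\<^sup>2"
  have cmin: "c * (norm w)\<^sup>2 \<le> (norm (A *v w))\<^sup>2" if w: "w \<in> span (rows A)" for w
  proof (cases "w = 0")
    case False
    have "c \<le> (norm (A *v ((1 / norm w) *\<^sub>R w)))\<^sup>2"
      unfolding c_def by (rule vmin) (use w False in \<open>simp add: span_scale\<close>)
    thus ?thesis
      using False by (simp add: matrix_vector_mult_scaleR power_divide field_simps)
  qed simp
  have v0: "v \<noteq> 0" using v by auto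
  hence "A *v v \<noteq> 0"
    using row_space_kernel_trivial v by blast
  hence cpos: "c > 0" by (simp add: c_def)
  have eig: "(transpose A ** A) *v v = c *\<^sub>R v"
    by (rule rayleigh_minimizer_eigenvector[OF v(1) _ cmin]) (simp_all add: c_def v)
  have "sigma_min A = sqrt c"
    unfolding sigma_min_def
  proof (rule Least_equality)
    show "sqrt c \<in> singular_values A \<and> sqrt c \<noteq> 0"
      using eig v0 cpos by (auto simp: singular_values_def)
  next
    fix s assume "s \<in> singular_values A \<and> s \<noteq> 0"
    then obtain l w where s: "s = sqrt l" "l \<noteq> 0"
      and w: "w \<noteq> 0" "(transpose A ** A) *v w = l *\<^sub>R w"
      by (auto simp: singular_values_def)
    have "w = transpose A *v (A *v ((1 / l) *\<^sub>R w))"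
      using w(2) s(2)
      by (simp add: matrix_vector_mul_assoc matrix_vector_mult_scaleR del: transpose_matrix_vector)
    hence "w \<in> span (rows A)"
      by (metis transpose_mult_in_row_space)
    hence "c * (norm w)\<^sup>2 \<le> (norm (A *v w))\<^sup>2"
      by (rule cmin)
    also have "(norm (A *v w))\<^sup>2 = (transpose A *v (A *v w)) \<bullet> w"
      by (simp add: inner_transpose_mult power2_norm_eq_inner del: transpose_matrix_vector)
    also have "\<dots> = l * (norm w)\<^sup>2"
      using w(2) by (simp add: matrix_vector_mul_assoc power2_norm_eq_inner del: transpose_matrix_vector)
    finally show "sqrt c \<le> s"
      using w(1) s by simp
  qed
  thus ?thesis
    using cmin[OF x] cpos by simp
qed

section \<open>Contraction of the averaged reflection\<close>

lemma frobenius_norm_rows: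
  fixes A :: "real^'n^'m"
  shows "(frobenius_norm A)\<^sup>2 = (\<Sum>i\<in>UNIV. (norm (row i A))\<^sup>2)"
  unfolding frobenius_norm_def power2_norm_eq_inner
  by (simp add: row_eq_nth sum_nonneg inner_vec_def flip: power2_eq_square)

lemma frobenius_norm_pos:
  fixes A :: "real^'n^'m"
  assumes "A \<noteq> 0"
  shows "0 < (frobenius_norm A)\<^sup>2"
proof -
  obtain i where "A $ i \<noteq> 0"
    using assms by (auto simp: vec_eq_iff)
  thus ?thesis
    unfolding frobenius_norm_rows by (intro sum_pos2[of _ i]) (auto simp: row_eq_nth)
qed

lemma bessel_two:
  fixes a u v :: "'a::real_inner"
  assumes "norm u = 1" "norm v = 1" "u \<bullet> v = 0"
  shows "(a \<bullet> u)\<^sup>2 + (a \<bullet> v)\<^sup>2 \<le> (norm a)\<^sup>2"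
proof -
  have "u \<bullet> u = 1" "v \<bullet> v = 1"
    using assms by (simp_all add: dot_square_norm)
  hence "(norm (a - (a \<bullet> u) *\<^sub>R u - (a \<bullet> v) *\<^sub>R v))\<^sup>2
      = (norm a)\<^sup>2 - (a \<bullet> u)\<^sup>2 - (a \<bullet> v)\<^sup>2"
    using assms(3) unfolding power2_norm_eq_inner
    by (simp add: inner_diff_left inner_diff_right inner_commute power2_eq_square algebra_simps)
  thus ?thesis
    by (metis diff_diff_eq diff_ge_0_iff_ge zero_le_power2)
qed

lemma norm_mult_orthonormal_pair:
  fixes A :: "real^'n^'m"
  assumes "norm u = 1" "norm v = 1" "u \<bullet> v = 0"
  shows "(norm (A *v u))\<^sup>2 + (norm (A *v v))\<^sup>2 \<le> (frobenius_norm A)\<^sup>2"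
proof -
  have "(norm (A *v u))\<^sup>2 + (norm (A *v v))\<^sup>2 = (\<Sum>i\<in>UNIV. (row i A \<bullet> u)\<^sup>2 + (row i A \<bullet> v)\<^sup>2)"
    unfolding power2_norm_eq_inner
    by (simp add: inner_vec_def matrix_vector_mul_component row_eq_nth sum.distrib power2_eq_square)
  also have "\<dots> \<le> (frobenius_norm A)\<^sup>2"
    unfolding frobenius_norm_rows by (intro sum_mono bessel_two assms)
  finally show ?thesis .
qed

text \<open>This is where the rank enters. The row space contains a unit vector orthogonal to \<open>v\<close>;
  it uses up at least \<open>\<sigma>\<^sub>m\<^sub>i\<^sub>n\<^sup>2\<close> of the squared Frobenius norm, and only the remainder is left
  for \<open>v\<close>.\<close>

lemma rayleigh_upper:
  fixes A :: "real^'n^'m"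
  assumes rank: "rank A \<ge> 2" and v: "v \<in> span (rows A)"
  shows "(norm (A *v v))\<^sup>2 \<le> ((frobenius_norm A)\<^sup>2 - (sigma_min A)\<^sup>2) * (norm v)\<^sup>2"
proof (cases "v = 0")
  case False
  have A0: "A \<noteq> 0" using rank by auto
  have "dim (span {v}) < dim (span (rows A))"
    using rank False by (simp add: row_rank_def)
  moreover have "span {v} \<subseteq> span (rows A)"
    using v by (simp add: span_minimal)
  ultimately have "span {v} \<subset> span (rows A)"
    by (metis dim_span less_irrefl psubsetI)
  then obtain u where u: "u \<noteq> 0" "u \<in> span (rows A)" and "\<And>y. y \<in> span {v} \<Longrightarrow> orthogonal u y"
    using orthogonal_to_subspace_exists_gen by blast
  hence uv: "u \<bullet> v = 0"
    by (simp add: orthogonal_def span_base)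
  let ?u = "(1 / norm u) *\<^sub>R u" and ?v = "(1 / norm v) *\<^sub>R v"
  have "(sigma_min A)\<^sup>2 * (norm ?u)\<^sup>2 \<le> (norm (A *v ?u))\<^sup>2"
    by (intro sigma_min_rayleigh A0 span_scale u)
  moreover have "(norm (A *v ?u))\<^sup>2 + (norm (A *v ?v))\<^sup>2 \<le> (frobenius_norm A)\<^sup>2"
    by (rule norm_mult_orthonormal_pair) (use u uv False in auto)
  ultimately have "(norm (A *v ?v))\<^sup>2 \<le> (frobenius_norm A)\<^sup>2 - (sigma_min A)\<^sup>2"
    using u by simp
  thus ?thesis
    using False by (simp add: matrix_vector_mult_scaleR power_divide field_simps)
qed simp

lemma sigma_min_le_frobenius:
  fixes A :: "real^'n^'m"
  assumes "rank A \<ge> 2"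
  shows "2 * (sigma_min A)\<^sup>2 \<le> (frobenius_norm A)\<^sup>2"
proof -
  have A0: "A \<noteq> 0" using assms by auto
  then obtain i where i: "row i A \<noteq> 0"
    by (auto simp: vec_eq_iff row_eq_nth)
  have R: "row i A \<in> span (rows A)"
    by (auto simp: rows_def intro: span_base)
  have "(sigma_min A)\<^sup>2 * (norm (row i A))\<^sup>2
      \<le> ((frobenius_norm A)\<^sup>2 - (sigma_min A)\<^sup>2) * (norm (row i A))\<^sup>2"
    using sigma_min_rayleigh[OF A0 R] rayleigh_upper[OF assms R] by linarith
  thus ?thesis using i by simp
qed

text \<open>The operator \<open>I - 2 A\<^sup>T A / \<parallel>A\<parallel>\<^sub>F\<^sup>2\<close>, which is the expectation of the linear part of a
  reflection in a row drawn with probability proportional to its squared norm.\<close>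

definition mean_reflection :: "real^'n^'m \<Rightarrow> real^'n \<Rightarrow> real^'n" where
  "mean_reflection A v = v - (2 / (frobenius_norm A)\<^sup>2) *\<^sub>R (transpose A *v (A *v v))"

lemma inner_mean_reflection:
  "mean_reflection A v \<bullet> w = v \<bullet> w - (2 / (frobenius_norm A)\<^sup>2) * ((A *v v) \<bullet> (A *v w))"
  by (simp add: mean_reflection_def inner_diff_left inner_transpose_mult
      del: transpose_matrix_vector)

lemma mean_reflection_row_space:
  "v \<in> span (rows A) \<Longrightarrow> mean_reflection A v \<in> span (rows A)"
  unfolding mean_reflection_def by (intro span_diff span_scale transpose_mult_in_row_space)

text \<open>The selection weights \<open>\<parallel>a\<^sub>i\<parallel>\<^sup>2\<close> cancel the denominators of the reflections; a zero row
  contributes nothing on either side.\<close>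

lemma mean_row_reflect:
  fixes A :: "real^'n^'m"
  assumes "A \<noteq> 0"
  shows "(\<Sum>i\<in>UNIV. (norm (row i A))\<^sup>2 / (frobenius_norm A)\<^sup>2 * (v \<bullet> row_reflect A 0 i w))
    = mean_reflection A v \<bullet> w"
proof -
  let ?F = "(frobenius_norm A)\<^sup>2"
  have F: "?F \<noteq> 0"
    using frobenius_norm_pos[OF assms] by simp
  have cancel: "c / ?F * (x - 2 * (y / c) * z) = c / ?F * x - 2 / ?F * (z * y)"
    if "c \<noteq> 0" for c x y z :: real
    using that by (simp add: right_diff_distrib)
  have "(norm (row i A))\<^sup>2 / ?F * (v \<bullet> row_reflect A 0 i w)
      = (norm (row i A))\<^sup>2 / ?F * (v \<bullet> w) - 2 / ?F * ((A *v v) $ i * (A *v w) $ i)" for i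
    using cancel[of "(norm (row i A))\<^sup>2" "v \<bullet> w" "row i A \<bullet> w" "row i A \<bullet> v"]
    by (cases "row i A = 0")
      (simp_all add: row_reflect_def inner_diff_right matrix_vector_mul_component row_eq_nth
        inner_commute)
  moreover have "(A *v v) \<bullet> (A *v w) = (\<Sum>i\<in>UNIV. (A *v v) $ i * (A *v w) $ i)"
    by (simp add: inner_vec_def)
  ultimately have "(\<Sum>i\<in>UNIV. (norm (row i A))\<^sup>2 / ?F * (v \<bullet> row_reflect A 0 i w))
      = (\<Sum>i\<in>UNIV. (norm (row i A))\<^sup>2) / ?F * (v \<bullet> w) - 2 / ?F * ((A *v v) \<bullet> (A *v w))"
    by (simp add: sum_subtractf sum_distrib_left sum_distrib_right sum_divide_distrib)
  thus ?thesis
    using F by (simp add: inner_mean_reflection flip: frobenius_norm_rows)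
qed

text \<open>For a symmetric operator the numerical range controls the norm; here by polarization,
  \<open>4 \<langle>T v, w\<rangle> = \<langle>T (v + w), v + w\<rangle> - \<langle>T (v - w), v - w\<rangle>\<close>, applied to the multiple \<open>w\<close> of
  \<open>T v\<close> that has the length of \<open>v\<close>.\<close>

lemma symmetric_norm_le_numerical_radius:
  fixes T :: "'a::real_inner \<Rightarrow> 'a"
  assumes T: "linear T" and S: "subspace S"
    and inv: "\<And>v. v \<in> S \<Longrightarrow> T v \<in> S"
    and sym: "\<And>v w. T v \<bullet> w = v \<bullet> T w"
    and num: "\<And>v. v \<in> S \<Longrightarrow> \<bar>T v \<bullet> v\<bar> \<le> \<rho> * (norm v)\<^sup>2"
    and v: "v \<in> S"
  shows "norm (T v) \<le> \<rho> * norm v"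
proof (cases "v = 0 \<or> T v = 0")
  case True
  show ?thesis
  proof (cases "v = 0")
    case False
    hence "0 < (norm v)\<^sup>2" and "0 \<le> \<rho> * (norm v)\<^sup>2"
      using num[OF v] abs_ge_zero order_trans by auto
    hence "0 \<le> \<rho>" by (simp add: zero_le_mult_iff)
    thus ?thesis using True False by simp
  qed (simp add: linear_0[OF T])
next
  case False
  hence nv: "norm v > 0" and nT: "norm (T v) > 0" by auto
  define w where "w = (norm v / norm (T v)) *\<^sub>R T v"
  have w: "w \<in> S"
    unfolding w_def by (intro subspace_scale S inv v)
  have nw: "norm w = norm v"
    using nT by (simp add: w_def)
  have Tw: "T v \<bullet> w = norm v * norm (T v)"
    using nT by (simp add: w_def dot_square_norm power2_eq_square)
  have "4 * (T v \<bullet> w) = T (v + w) \<bullet> (v + w) - T (v - w) \<bullet> (v - w)"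
    using sym[of w v]
    by (simp add: linear_add[OF T] linear_diff[OF T] inner_add_left inner_add_right
        inner_diff_left inner_diff_right inner_commute)
  also have "\<dots> \<le> \<rho> * (norm (v + w))\<^sup>2 + \<rho> * (norm (v - w))\<^sup>2"
    using num[OF subspace_add[OF S v w]] num[OF subspace_diff[OF S v w]] by linarith
  also have "\<dots> = \<rho> * (2 * (norm v)\<^sup>2 + 2 * (norm w)\<^sup>2)"
    unfolding power2_norm_eq_inner
    by (simp add: inner_add_left inner_add_right inner_diff_left inner_diff_right inner_commute
        algebra_simps)
  finally have "norm v * norm (T v) \<le> norm v * (\<rho> * norm v)"
    unfolding Tw nw by (simp add: power2_eq_square algebra_simps)
  thus ?thesis using nv by simp
qed

lemma mean_reflection_contraction:
  fixes A :: "real^'n^'m"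
  assumes rank: "rank A \<ge> 2" and v: "v \<in> span (rows A)"
  shows "norm (mean_reflection A v)
    \<le> (1 - 2 * (sigma_min A)\<^sup>2 / (frobenius_norm A)\<^sup>2) * norm v"
proof (rule symmetric_norm_le_numerical_radius[OF _ subspace_span mean_reflection_row_space _ _ v])
  let ?F = "(frobenius_norm A)\<^sup>2" and ?s = "(sigma_min A)\<^sup>2"
  have A0: "A \<noteq> 0" using rank by auto
  have F: "?F > 0" by (rule frobenius_norm_pos[OF A0])
  show "linear (mean_reflection A)"
    by (rule linearI) (simp_all add: mean_reflection_def matrix_vector_right_distrib
        matrix_vector_mult_scaleR algebra_simps del: transpose_matrix_vector)
  show "mean_reflection A v \<bullet> w = v \<bullet> mean_reflection A w" for v w
    by (metis inner_commute inner_mean_reflection)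
  show "\<bar>mean_reflection A v \<bullet> v\<bar> \<le> (1 - 2 * ?s / ?F) * (norm v)\<^sup>2"
    if v: "v \<in> span (rows A)" for v
  proof -
    let ?q = "(norm (A *v v))\<^sup>2"
    have eq: "mean_reflection A v \<bullet> v = (norm v)\<^sup>2 - 2 * ?q / ?F"
      by (simp add: inner_mean_reflection power2_norm_eq_inner)
    have "?s * (norm v)\<^sup>2 / ?F \<le> ?q / ?F"
      using sigma_min_rayleigh[OF A0 v] F by (simp add: divide_right_mono)
    moreover have "?q / ?F \<le> (?F - ?s) * (norm v)\<^sup>2 / ?F"
      using rayleigh_upper[OF rank v] F by (simp add: divide_right_mono)
    moreover have "(?F - ?s) * (norm v)\<^sup>2 / ?F = (norm v)\<^sup>2 - ?s * (norm v)\<^sup>2 / ?F"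
      using F by (simp add: field_simps)
    moreover have "(1 - 2 * ?s / ?F) * (norm v)\<^sup>2 = (norm v)\<^sup>2 - 2 * (?s * (norm v)\<^sup>2 / ?F)"
      by (simp add: algebra_simps)
    ultimately show ?thesis
      unfolding eq by (simp add: abs_le_iff)
  qed
qed

lemma mean_reflection_power_contraction:
  fixes A :: "real^'n^'m"
  assumes rank: "rank A \<ge> 2" and v: "v \<in> span (rows A)"
  shows "norm ((mean_reflection A ^^ l) v)
    \<le> (1 - 2 * (sigma_min A)\<^sup>2 / (frobenius_norm A)\<^sup>2) ^ l * norm v"
proof -
  let ?\<rho> = "1 - 2 * (sigma_min A)\<^sup>2 / (frobenius_norm A)\<^sup>2"
  have \<rho>: "0 \<le> ?\<rho>"
    using sigma_min_le_frobenius[OF rank] frobenius_norm_pos[of A] rank by fastforce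
  have "(mean_reflection A ^^ l) v \<in> span (rows A) \<and>
      norm ((mean_reflection A ^^ l) v) \<le> ?\<rho> ^ l * norm v"
  proof (induction l)
    case (Suc l)
    have "norm (mean_reflection A ((mean_reflection A ^^ l) v))
        \<le> ?\<rho> * norm ((mean_reflection A ^^ l) v)"
      using mean_reflection_contraction[OF rank] Suc.IH by blast
    also have "\<dots> \<le> ?\<rho> * (?\<rho> ^ l * norm v)"
      using Suc.IH \<rho> by (intro mult_left_mono) auto
    finally show ?case
      using Suc.IH by (simp add: mean_reflection_row_space mult.assoc)
  qed (simp add: v)
  thus ?thesis ..
qed

section \<open>Averaging over one selection\<close>

text \<open>Functions of the whole table of selections that look only at the entries in \<open>S\<close>. If
  \<open>S\<close> and the set of possible entries are finite, they take finitely many values, so they are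
  integrable along a random table with measurable entries.\<close>

definition determined_by :: "'s set \<Rightarrow> (('s \<Rightarrow> 'a) \<Rightarrow> 'b) \<Rightarrow> bool" where
  "determined_by S f \<longleftrightarrow> (\<forall>x y. (\<forall>s\<in>S. x s = y s) \<longrightarrow> f x = f y)"

lemma determined_byD:
  "determined_by S f \<Longrightarrow> (\<And>s. s \<in> S \<Longrightarrow> x s = y s) \<Longrightarrow> f x = f y"
  by (simp add: determined_by_def)

lemma determined_by_compose: "determined_by S f \<Longrightarrow> determined_by S (\<lambda>x. g (f x))"
  unfolding determined_by_def by (intro allI impI arg_cong[of _ _ g]) blast

lemma determined_by_restrict: "determined_by S f \<Longrightarrow> f (restrict x S) = f x"
  unfolding determined_by_def by (simp add: restrict_def)

context prob_space
begin

lemma random_variable_restrict: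
  fixes X :: "'s \<Rightarrow> 'a \<Rightarrow> 'm::finite"
  assumes X: "\<And>s. s \<in> S \<Longrightarrow> X s \<in> measurable M (count_space UNIV)" and S: "finite S"
  shows "(\<lambda>\<omega>. restrict (\<lambda>s. X s \<omega>) S) \<in> measurable M (count_space (PiE S (\<lambda>_. UNIV)))"
proof -
  have "(\<lambda>\<omega>. restrict (\<lambda>s. X s \<omega>) S) \<in> measurable M (PiM S (\<lambda>_. count_space UNIV))"
    by (intro measurable_restrict X)
  thus ?thesis
    by (subst (asm) count_space_PiM_finite[OF S]) auto
qed

lemma integrable_determined:
  fixes X :: "'s \<Rightarrow> 'a \<Rightarrow> 'm::finite" and f :: "('s \<Rightarrow> 'm) \<Rightarrow> real"
  assumes X: "\<And>s. s \<in> S \<Longrightarrow> X s \<in> measurable M (count_space UNIV)" and S: "finite S"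
    and f: "determined_by S f"
  shows "integrable M (\<lambda>\<omega>. f (\<lambda>s. X s \<omega>))"
proof -
  let ?P = "PiE S (\<lambda>_. UNIV :: 'm set)"
  have eq: "(\<lambda>\<omega>. f (\<lambda>s. X s \<omega>)) = (\<lambda>\<omega>. f (restrict (\<lambda>s. X s \<omega>) S))"
    by (simp add: determined_by_restrict[OF f])
  have fin: "finite ?P" by (intro finite_PiE S) auto
  show ?thesis
  proof (rule integrable_const_bound)
    show "AE \<omega> in M. norm (f (\<lambda>s. X s \<omega>)) \<le> (\<Sum>x\<in>?P. \<bar>f x\<bar>)"
    proof (rule AE_I2)
      fix \<omega>
      show "norm (f (\<lambda>s. X s \<omega>)) \<le> (\<Sum>x\<in>?P. \<bar>f x\<bar>)"
        unfolding determined_by_restrict[OF f, of "\<lambda>s. X s \<omega>", symmetric] real_norm_def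
        by (rule member_le_sum[OF _ _ fin]) auto
    qed
    show "(\<lambda>\<omega>. f (\<lambda>s. X s \<omega>)) \<in> borel_measurable M"
      unfolding eq by (rule measurable_compose[OF random_variable_restrict[OF X S]]) auto
  qed
qed

text \<open>Conditioning on the finitely many selections in \<open>S\<close>, a fresh selection \<open>X p\<close> may be
  replaced by its average. The indicator of each event \<open>X p = i\<close> is independent of the factor
  determined by \<open>S\<close>.\<close>

lemma expectation_fresh_selection:
  fixes X :: "'s \<Rightarrow> 'a \<Rightarrow> 'm::finite" and f :: "'m \<Rightarrow> ('s \<Rightarrow> 'm) \<Rightarrow> real"
  assumes ind: "indep_vars (\<lambda>_. count_space UNIV) X I"
    and S: "finite S" "S \<subseteq> I" and p: "p \<in> I" "p \<notin> S"
    and f: "\<And>i. determined_by S (f i)"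
  shows "expectation (\<lambda>\<omega>. f (X p \<omega>) (\<lambda>s. X s \<omega>))
    = expectation (\<lambda>\<omega>. \<Sum>i\<in>UNIV. prob {\<omega>\<in>space M. X p \<omega> = i} * f i (\<lambda>s. X s \<omega>))"
proof -
  have X: "X s \<in> measurable M (count_space UNIV)" if "s \<in> I" for s
    using ind that by (auto simp: indep_vars_def)
  have int: "integrable M (\<lambda>\<omega>. f i (\<lambda>s. X s \<omega>))" for i
    by (rule integrable_determined[OF X S(1) f]) (use S in auto)
  let ?ind = "\<lambda>i \<omega>. indicator {i} (X p \<omega>) :: real"
  have int1: "integrable M (?ind i)" for i
    by (rule integrable_const_bound[of _ 1])
      (auto intro!: measurable_compose[OF X[OF p(1)]] simp: indicator_def)
  have E1: "expectation (?ind i) = prob {\<omega>\<in>space M. X p \<omega> = i}" for i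
  proof -
    have "{\<omega>\<in>space M. X p \<omega> = i} \<in> events"
      using measurable_sets[OF X[OF p(1)], of "{i}"] by (simp add: vimage_def Int_def conj_commute)
    moreover have "expectation (?ind i) = expectation (indicator {\<omega>\<in>space M. X p \<omega> = i})"
      by (rule Bochner_Integration.integral_cong) (auto simp: indicator_def)
    ultimately show ?thesis by simp
  qed
  have indep: "indep_var borel (?ind i) borel (\<lambda>\<omega>. f i (\<lambda>s. X s \<omega>))" for i
  proof -
    let ?C = "\<lambda>_::'s. count_space (UNIV :: 'm set)"
    have "indep_var borel ((\<lambda>x. indicator {i} (x p)) \<circ> (\<lambda>\<omega>. restrict (\<lambda>s. X s \<omega>) {p}))
        borel (f i \<circ> (\<lambda>\<omega>. restrict (\<lambda>s. X s \<omega>) S))"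
    proof (rule indep_var_compose[OF indep_var_restrict[OF ind]])
      show "(\<lambda>x. indicator {i} (x p)) \<in> borel_measurable (PiM {p} ?C)"
        by (subst count_space_PiM_finite) auto
      show "f i \<in> borel_measurable (PiM S ?C)"
        by (subst count_space_PiM_finite) (auto simp: S)
    qed (use S p in auto)
    thus ?thesis
      by (simp add: o_def determined_by_restrict[OF f])
  qed
  have "expectation (\<lambda>\<omega>. f (X p \<omega>) (\<lambda>s. X s \<omega>))
      = expectation (\<lambda>\<omega>. \<Sum>i\<in>UNIV. ?ind i \<omega> * f i (\<lambda>s. X s \<omega>))"
    by (simp add: indicator_def if_distrib[of "\<lambda>c. c * _"] cong: if_cong)
  also have "\<dots> = (\<Sum>i\<in>UNIV. expectation (\<lambda>\<omega>. ?ind i \<omega> * f i (\<lambda>s. X s \<omega>)))"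
    by (intro Bochner_Integration.integral_sum indep_var_integrable[OF indep int1 int])
  also have "\<dots> = (\<Sum>i\<in>UNIV. prob {\<omega>\<in>space M. X p \<omega> = i} * expectation (\<lambda>\<omega>. f i (\<lambda>s. X s \<omega>)))"
    by (simp add: indep_var_lebesgue_integral[OF indep int1 int] E1)
  also have "\<dots> = expectation (\<lambda>\<omega>. \<Sum>i\<in>UNIV. prob {\<omega>\<in>space M. X p \<omega> = i} * f i (\<lambda>s. X s \<omega>))"
    by (subst Bochner_Integration.integral_sum) (auto intro: int)
  finally show ?thesis .
qed

end

section \<open>The error of the iteration\<close>

text \<open>Reflections in hyperplanes through a common point \<open>x\<close> are linear about \<open>x\<close>, so the error
  follows the same iteration for the homogeneous system.\<close>

lemma row_reflect_error:
  "row_reflect A (A *v x) i z - x = row_reflect A 0 i (z - x)"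
  by (simp add: row_reflect_def row_eq_nth matrix_vector_mul_component inner_diff_right
      algebra_simps)

lemma rrdr_inner_error:
  "rrdr_inner A (A *v x) j z l - x = rrdr_inner A 0 j (z - x) l"
  by (induction l) (simp_all add: row_reflect_error)

lemma rrdr_error:
  "rrdr A (A *v x) r \<alpha> x0 j k - x = rrdr A 0 r \<alpha> (x0 - x) j k"
proof (induction k)
  case (Suc k)
  let ?y = "rrdr A (A *v x) r \<alpha> x0 j k"
  have "rrdr A (A *v x) r \<alpha> x0 j (Suc k) - x
      = (1 - \<alpha>) *\<^sub>R (?y - x) + \<alpha> *\<^sub>R (rrdr_inner A (A *v x) (j k) ?y r - x)"
    by (simp add: algebra_simps)
  thus ?case
    by (simp add: Suc.IH rrdr_inner_error)
qed simp

lemma row_reflect_row_space: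
  assumes "z \<in> span (rows A)"
  shows "row_reflect A 0 i z \<in> span (rows A)"
  unfolding row_reflect_def
  by (intro span_diff span_scale assms span_base) (auto simp: rows_def)

lemma rrdr_inner_row_space:
  "z \<in> span (rows A) \<Longrightarrow> rrdr_inner A 0 j z l \<in> span (rows A)"
  by (induction l) (simp_all add: row_reflect_row_space)

lemma rrdr_row_space:
  "z \<in> span (rows A) \<Longrightarrow> rrdr A 0 r \<alpha> z j k \<in> span (rows A)"
  by (induction k) (simp_all add: span_add span_scale rrdr_inner_row_space)

lemma norm_row_reflect: "norm (row_reflect A 0 i z) = norm z"
proof (cases "row i A = 0")
  case False
  hence "row i A \<bullet> row i A \<noteq> 0" by simp
  hence "row_reflect A 0 i z \<bullet> row_reflect A 0 i z = z \<bullet> z"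
    unfolding row_reflect_def power2_norm_eq_inner
    by (simp add: inner_diff_left inner_diff_right inner_commute field_simps power2_eq_square)
  thus ?thesis by (simp add: norm_eq)
qed (simp add: row_reflect_def)

lemma norm_rrdr_inner: "norm (rrdr_inner A 0 j z l) = norm z"
  by (induction l) (simp_all add: norm_row_reflect)

lemma norm_rrdr_Suc:
  fixes A :: "real^'n^'m" and r j z \<alpha>
  defines "e \<equiv> \<lambda>k. rrdr A 0 r \<alpha> z j k"
  shows "(norm (e (Suc k)))\<^sup>2 = (\<alpha>\<^sup>2 + (1 - \<alpha>)\<^sup>2) * (norm (e k))\<^sup>2
    + 2 * \<alpha> * (1 - \<alpha>) * (e k \<bullet> rrdr_inner A 0 (j k) (e k) r)"
proof -
  let ?w = "rrdr_inner A 0 (j k) (e k) r"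
  have w: "?w \<bullet> ?w = e k \<bullet> e k"
    using norm_rrdr_inner[of A "j k" "e k" r] by (simp only: norm_eq)
  have "(norm (e (Suc k)))\<^sup>2 = (norm ((1 - \<alpha>) *\<^sub>R e k + \<alpha> *\<^sub>R ?w))\<^sup>2"
    by (simp add: e_def)
  also have "\<dots> = (1 - \<alpha>)\<^sup>2 * (e k \<bullet> e k) + 2 * \<alpha> * (1 - \<alpha>) * (e k \<bullet> ?w) + \<alpha>\<^sup>2 * (?w \<bullet> ?w)"
    unfolding power2_norm_eq_inner
    by (simp add: inner_add_left inner_add_right inner_commute power2_eq_square algebra_simps)
  finally show ?thesis
    unfolding w power2_norm_eq_inner by (simp add: algebra_simps)
qed

lemma rrdr_inner_cong:
  "(\<And>i. i \<in> {1..l} \<Longrightarrow> j i = j' i) \<Longrightarrow> rrdr_inner A b j z l = rrdr_inner A b j' z l"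
  by (induction l) auto

lemma rrdr_cong:
  "(\<And>i l. i < k \<Longrightarrow> l \<in> {1..r} \<Longrightarrow> j i l = j' i l)
    \<Longrightarrow> rrdr A b r \<alpha> z j k = rrdr A b r \<alpha> z j' k"
proof (induction k)
  case (Suc k)
  have "rrdr A b r \<alpha> z j k = rrdr A b r \<alpha> z j' k"
    by (rule Suc.IH) (use Suc.prems in auto)
  moreover have "rrdr_inner A b (j k) y r = rrdr_inner A b (j' k) y r" for y
    by (rule rrdr_inner_cong) (use Suc.prems in auto)
  ultimately show ?case by simp
qed simp

lemma determined_by_rrdr:
  "determined_by ({..<k} \<times> {1..r}) (\<lambda>x. rrdr A b r \<alpha> z (curry x) k)"
  unfolding determined_by_def by (intro allI impI rrdr_cong) auto

context prob_space
begin

text \<open>The last reflection of the inner loop is averaged first: it is fresh with respect to all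
  earlier ones, and by symmetry its mean can be moved to the other side of the inner product.
  This removes the reflections one by one.\<close>

lemma expectation_inner_rrdr_inner:
  fixes A :: "real^'n^'m" and J :: "nat \<Rightarrow> nat \<Rightarrow> 'a \<Rightarrow> 'm"
    and r k l :: nat and u e :: "(nat \<times> nat \<Rightarrow> 'm) \<Rightarrow> real^'n"
  defines "X \<equiv> \<lambda>\<omega> (k, l). J k l \<omega>"
  assumes samp: "rrdr_sampling A r M J" and A: "A \<noteq> 0" and l: "l \<le> r"
    and u: "determined_by ({..<k} \<times> {1..r}) u" and e: "determined_by ({..<k} \<times> {1..r}) e"
  shows "expectation (\<lambda>\<omega>. u (X \<omega>) \<bullet> rrdr_inner A 0 (\<lambda>l. J k l \<omega>) (e (X \<omega>)) l)
    = expectation (\<lambda>\<omega>. (mean_reflection A ^^ l) (u (X \<omega>)) \<bullet> e (X \<omega>))"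
  using l u
proof (induction l arbitrary: u)
  case (Suc l)
  let ?S = "{..<k} \<times> {1..r} \<union> {k} \<times> {1..l}"
  define Y where "Y = (\<lambda>(k, l). J k l)"
  have XY: "X \<omega> = (\<lambda>s. Y s \<omega>)" for \<omega>
    by (auto simp: X_def Y_def)
  have ind: "indep_vars (\<lambda>_. count_space UNIV) Y (UNIV \<times> {1..r})"
    using samp by (simp add: rrdr_sampling_def Y_def)
  have prob: "prob {\<omega>\<in>space M. Y (k, Suc l) \<omega> = i} = (norm (row i A))\<^sup>2 / (frobenius_norm A)\<^sup>2" for i
    using samp Suc.prems by (simp add: rrdr_sampling_def Y_def)
  define z where "z x = rrdr_inner A 0 (\<lambda>l. x (k, l)) (e x) l" for x
  define f where "f i x = u x \<bullet> row_reflect A 0 i (z x)" for i x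
  have z: "determined_by ?S z"
    unfolding determined_by_def
  proof (intro allI impI)
    fix x y :: "nat \<times> nat \<Rightarrow> 'm"
    assume xy: "\<forall>s\<in>?S. x s = y s"
    have "e x = e y"
      by (rule determined_byD[OF e]) (use xy in blast)
    thus "z x = z y"
      unfolding z_def using xy by (auto intro!: rrdr_inner_cong)
  qed
  have f: "determined_by ?S (f i)" for i
    unfolding determined_by_def
  proof (intro allI impI)
    fix x y :: "nat \<times> nat \<Rightarrow> 'm"
    assume xy: "\<forall>s\<in>?S. x s = y s"
    have "u x = u y"
      by (rule determined_byD[OF Suc.prems(2)]) (use xy in blast)
    moreover have "z x = z y"
      by (rule determined_byD[OF z]) (use xy in blast)
    ultimately show "f i x = f i y"
      by (simp add: f_def)
  qed
  have "expectation (\<lambda>\<omega>. u (X \<omega>) \<bullet> rrdr_inner A 0 (\<lambda>l. J k l \<omega>) (e (X \<omega>)) (Suc l))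
      = expectation (\<lambda>\<omega>. f (Y (k, Suc l) \<omega>) (\<lambda>s. Y s \<omega>))"
    by (simp add: f_def z_def XY Y_def)
  also have "\<dots> = expectation (\<lambda>\<omega>. \<Sum>i\<in>UNIV. prob {\<omega>\<in>space M. Y (k, Suc l) \<omega> = i} * f i (\<lambda>s. Y s \<omega>))"
    by (rule expectation_fresh_selection[OF ind _ _ _ _ f]) (use Suc.prems in auto)
  also have "\<dots> = expectation (\<lambda>\<omega>. mean_reflection A (u (X \<omega>)) \<bullet> z (X \<omega>))"
    by (simp only: prob f_def mean_row_reflect[OF A] XY)
  also have "\<dots> = expectation (\<lambda>\<omega>. mean_reflection A (u (X \<omega>))
      \<bullet> rrdr_inner A 0 (\<lambda>l. J k l \<omega>) (e (X \<omega>)) l)"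
    by (simp add: z_def X_def)
  also have "\<dots> = expectation (\<lambda>\<omega>. (mean_reflection A ^^ l) (mean_reflection A (u (X \<omega>))) \<bullet> e (X \<omega>))"
    by (rule Suc.IH) (use Suc.prems in \<open>auto intro: determined_by_compose\<close>)
  finally show ?case
    by (simp only: funpow_Suc_right o_apply)
qed simp

text \<open>One outer step. The cross term in the squared norm is the only one that depends on the
  new selections, and its mean is at most \<open>\<rho>\<^sup>r \<parallel>e\<parallel>\<^sup>2\<close> because the error \<open>e\<close> stays in the row
  space, where the averaged reflection contracts.\<close>

lemma rrdr_step_expectation:
  fixes A :: "real^'n^'m" and J :: "nat \<Rightarrow> nat \<Rightarrow> 'a \<Rightarrow> 'm" and r k \<alpha> z
  defines "\<rho> \<equiv> 1 - 2 * (sigma_min A)\<^sup>2 / (frobenius_norm A)\<^sup>2"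
    and "e \<equiv> \<lambda>k \<omega>. rrdr A 0 r \<alpha> z (\<lambda>k l. J k l \<omega>) k"
  assumes samp: "rrdr_sampling A r M J" and rank: "rank A \<ge> 2"
    and \<alpha>: "0 < \<alpha>" "\<alpha> < 1" and z: "z \<in> span (rows A)"
  shows "expectation (\<lambda>\<omega>. (norm (e (Suc k) \<omega>))\<^sup>2)
    \<le> (\<alpha>\<^sup>2 + (1 - \<alpha>)\<^sup>2 + 2 * \<alpha> * (1 - \<alpha>) * \<rho> ^ r) * expectation (\<lambda>\<omega>. (norm (e k \<omega>))\<^sup>2)"
proof -
  define Y where "Y = (\<lambda>(k, l). J k l)"
  have "indep_vars (\<lambda>_. count_space UNIV) Y (UNIV \<times> {1..r})"
    using samp by (simp add: rrdr_sampling_def Y_def)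
  hence meas: "Y s \<in> measurable M (count_space UNIV)" if "s \<in> UNIV \<times> {1..r}" for s
    using that by (auto simp: indep_vars_def)
  define E where "E k x = rrdr A 0 r \<alpha> z (curry x) k" for k and x :: "nat \<times> nat \<Rightarrow> 'm"
  have eE: "e k \<omega> = E k (\<lambda>s. Y s \<omega>)" for k \<omega>
    by (simp add: e_def E_def Y_def curry_def)
  have det: "determined_by ({..<k} \<times> {1..r}) (E k)" for k
    unfolding E_def by (rule determined_by_rrdr)
  have int: "integrable M (\<lambda>\<omega>. g (e k \<omega>))" for g :: "real^'n \<Rightarrow> real" and k
    unfolding eE
  proof (rule integrable_determined)
    show "determined_by ({..<k} \<times> {1..r}) (\<lambda>x. g (E k x))"
      by (rule determined_by_compose[OF det])
  qed (auto intro: meas)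
  note int_sq = int[of "\<lambda>v. (norm v)\<^sup>2"]
  have Esq: "(norm (e (Suc k) \<omega>))\<^sup>2 = (\<alpha>\<^sup>2 + (1 - \<alpha>)\<^sup>2) * (norm (e k \<omega>))\<^sup>2
      + 2 * \<alpha> * (1 - \<alpha>) * (e k \<omega> \<bullet> rrdr_inner A 0 (\<lambda>l. J k l \<omega>) (e k \<omega>) r)" for \<omega>
    unfolding e_def by (rule norm_rrdr_Suc)
  let ?cross = "\<lambda>\<omega>. e k \<omega> \<bullet> rrdr_inner A 0 (\<lambda>l. J k l \<omega>) (e k \<omega>) r"
  have intc: "integrable M ?cross"
  proof -
    \<comment> \<open>solving the step identity for the cross term leaves only squared norms of errors\<close>
    have "?cross = (\<lambda>\<omega>. ((norm (e (Suc k) \<omega>))\<^sup>2 - (\<alpha>\<^sup>2 + (1 - \<alpha>)\<^sup>2) * (norm (e k \<omega>))\<^sup>2)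
        / (2 * \<alpha> * (1 - \<alpha>)))"
      using \<alpha> by (simp add: Esq)
    thus ?thesis
      by (auto intro!: Bochner_Integration.integrable_diff integrable_mult_right int_sq)
  qed
  have cross: "expectation ?cross \<le> \<rho> ^ r * expectation (\<lambda>\<omega>. (norm (e k \<omega>))\<^sup>2)"
  proof -
    have "A \<noteq> 0" using rank by auto
    moreover have "(\<lambda>(k, l). J k l \<omega>) = (\<lambda>s. Y s \<omega>)" for \<omega>
      by (auto simp: Y_def)
    ultimately have "expectation ?cross
        = expectation (\<lambda>\<omega>. (mean_reflection A ^^ r) (e k \<omega>) \<bullet> e k \<omega>)"
      using expectation_inner_rrdr_inner[OF samp _ order_refl det det, of k] by (simp add: eE)
    also have "\<dots> \<le> expectation (\<lambda>\<omega>. \<rho> ^ r * (norm (e k \<omega>))\<^sup>2)"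
    proof (rule integral_mono)
      fix \<omega>
      have "e k \<omega> \<in> span (rows A)"
        unfolding e_def by (rule rrdr_row_space[OF z])
      from mean_reflection_power_contraction[OF rank this, of r]
      have "norm ((mean_reflection A ^^ r) (e k \<omega>)) * norm (e k \<omega>)
          \<le> \<rho> ^ r * norm (e k \<omega>) * norm (e k \<omega>)"
        unfolding \<rho>_def by (intro mult_right_mono) auto
      thus "(mean_reflection A ^^ r) (e k \<omega>) \<bullet> e k \<omega> \<le> \<rho> ^ r * (norm (e k \<omega>))\<^sup>2"
        using norm_cauchy_schwarz[of "(mean_reflection A ^^ r) (e k \<omega>)" "e k \<omega>"]
        by (simp add: power2_eq_square mult.assoc)
    next
      show "integrable M (\<lambda>\<omega>. (mean_reflection A ^^ r) (e k \<omega>) \<bullet> e k \<omega>)"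
        by (rule int[of "\<lambda>v. (mean_reflection A ^^ r) v \<bullet> v"])
    qed (intro integrable_mult_right int_sq)
    finally show ?thesis by simp
  qed
  have "expectation (\<lambda>\<omega>. (norm (e (Suc k) \<omega>))\<^sup>2)
      = (\<alpha>\<^sup>2 + (1 - \<alpha>)\<^sup>2) * expectation (\<lambda>\<omega>. (norm (e k \<omega>))\<^sup>2)
        + 2 * \<alpha> * (1 - \<alpha>) * expectation ?cross"
    unfolding Esq using int_sq[of k] intc by simp
  also have "\<dots> \<le> (\<alpha>\<^sup>2 + (1 - \<alpha>)\<^sup>2) * expectation (\<lambda>\<omega>. (norm (e k \<omega>))\<^sup>2)
        + 2 * \<alpha> * (1 - \<alpha>) * (\<rho> ^ r * expectation (\<lambda>\<omega>. (norm (e k \<omega>))\<^sup>2))"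
    using \<alpha> by (intro add_left_mono mult_left_mono cross) auto
  finally show ?thesis
    by (simp add: algebra_simps)
qed

end

section \<open>Linear convergence in mean square\<close>

theorem theorem3p1:
  fixes A :: "real^'n^'m" and b :: "real^'m" and x0 xstar :: "real^'n"
    and r :: nat and \<alpha> :: real
    and M :: "'w measure" and J :: "nat \<Rightarrow> nat \<Rightarrow> 'w \<Rightarrow> 'm" and k :: nat
  assumes "rank A \<ge> 2"
    and "\<exists>x. A *v x = b"
    and "r > 0" and "0 < \<alpha>" and "\<alpha> < 1"
    and "prob_space M" and "rrdr_sampling A r M J"
    and "xstar = pinv A *v b + (mat 1 - pinv A ** A) *v x0"
  shows "prob_space.expectation M
      (\<lambda>\<omega>. (norm (rrdr A b r \<alpha> x0 (\<lambda>k l. J k l \<omega>) k - xstar))\<^sup>2)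
    \<le> (\<alpha>\<^sup>2 + (1 - \<alpha>)\<^sup>2
         + 2 * \<alpha> * (1 - \<alpha>) * (1 - 2 * (sigma_min A)\<^sup>2 / (frobenius_norm A)\<^sup>2) ^ r) ^ k
      * (norm (x0 - xstar))\<^sup>2"
proof -
  interpret prob_space M by fact
  let ?c = "\<alpha>\<^sup>2 + (1 - \<alpha>)\<^sup>2
    + 2 * \<alpha> * (1 - \<alpha>) * (1 - 2 * (sigma_min A)\<^sup>2 / (frobenius_norm A)\<^sup>2) ^ r"
  have b: "A *v xstar = b" and R: "x0 - xstar \<in> span (rows A)"
    using pinv_projection_solves pinv_projection_diff assms by blast+
  have "0 \<le> 1 - 2 * (sigma_min A)\<^sup>2 / (frobenius_norm A)\<^sup>2"
    using sigma_min_le_frobenius[OF assms(1)] frobenius_norm_pos[of A] assms(1) by fastforce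
  hence c: "0 \<le> ?c"
    using assms by (intro add_nonneg_nonneg mult_nonneg_nonneg) auto
  have "expectation (\<lambda>\<omega>. (norm (rrdr A 0 r \<alpha> (x0 - xstar) (\<lambda>k l. J k l \<omega>) k))\<^sup>2)
      \<le> ?c ^ k * (norm (x0 - xstar))\<^sup>2"
  proof (induction k)
    case (Suc k)
    have "expectation (\<lambda>\<omega>. (norm (rrdr A 0 r \<alpha> (x0 - xstar) (\<lambda>k l. J k l \<omega>) (Suc k)))\<^sup>2)
        \<le> ?c * expectation (\<lambda>\<omega>. (norm (rrdr A 0 r \<alpha> (x0 - xstar) (\<lambda>k l. J k l \<omega>) k))\<^sup>2)"
      by (rule rrdr_step_expectation) (use assms R in auto)
    also have "\<dots> \<le> ?c * (?c ^ k * (norm (x0 - xstar))\<^sup>2)"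
      by (rule mult_left_mono[OF Suc.IH c])
    finally show ?case by (simp only: power_Suc mult.assoc)
  qed (simp add: prob_space)
  thus ?thesis
    by (simp only: rrdr_error flip: b)
qed

end
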